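(* Let $p\in(1/2,1)$, $q=1-p$, and let $\bar g=\{g_j\}_{j\in\mathbb N}$ be a real sequence with $\sup_j|g_j|<\infty$. Let $\gamma$ be a probability measure on $\mathbb R^\infty$ such that $\gamma$-a.e. $\bar x=\{x_j\}_{j\in\mathbb N}$ is non-decreasing and satisfies $$\limsup_{M\to\infty}\frac{x_M}{\sqrt M}=\infty .$$ Then solutions to the infinite system of competing Brownian particles with parameters $p,\bar g$ and initial distribution $\gamma$ are pathwise unique among all solutions whose associated local times $\{L_{(j,j+1)}\}$ satisfy: for all $T\in[0,\infty)$, $$\lim_{M\to\infty}\left(\frac qp\right)^M L_{(M,M+1)}(T)=0\quad\text{a.s.}$$ That is, if $\{X_j\}$ and $\{X'_j\}$ are two solutions to the infinite system of competing Brownian particles with parameters $p,\bar g$ on the same filtered probability space, with the same driving Brownian motions, initial distribution $\gamma$, and $X_j(0)=X'_j(0)$ for all $j$, and if the local times $\{L_{(j,j+1)}\}$ of $\{X_j\}$ and $\{L'_{(j,j+1)}\}$ of $\{X'_j\}$ satisfy, for all $T\in[0,\infty)$, $\lim_{M\to\infty}(q/p)^M L_{(M,M+1)}(T)=0$ a.s. and $\lim_{M\to\infty}(q/p)^M L'_{(M,M+1)}(T)=0$ a.s., then almost surely $X_j(t)=X'_j(t)$ for all $j\in\mathbb N$ and $t\in[0,\infty)$.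
   Context: Setting. $(\Omega,\mathcal F,\{\mathcal F_t\}_{t\ge0},\mathbb P)$ is a filtered probability space carrying independent standard one-dimensional ($\mathcal F_t$-adapted) Brownian motions $\{B_j\}_{j\in\mathbb N}$ such that $\{B_i(t+\cdot)-B_i(t),\,i\in\mathbb N\}$ is independent of $\mathcal F_t$ for all $t\ge0$, and $\bar x=\{x_j\}_{j\in\mathbb N}$ is a non-decreasing sequence of real $\mathcal F_0$-measurable random variables (initial conditions); the law of $\bar x$ is the initial distribution. An infinite system of competing Brownian particles (a solution) with parameters $p,\bar g$, initial conditions $\bar x$ and driving Brownian motions $\{B_j\}$ is a collection $\{X_j\}_{j\in\mathbb N}$ of continuous, real-valued, $\{\mathcal F_t\}$-adapted processes for which there are continuous, real-valued, $\{\mathcal F_t\}$-adapted processes $\{L_{(j,j+1)}\}_{j\ge0}$ (the associated local times) such that: (P1) for all $t\ge0$, $j\in\mathbb N$: $X_j(t)=x_j+g_jt+B_j(t)+pL_{(j-1,j)}(t)-qL_{(j,j+1)}(t)$; (P2) for all $t\ge0$ the sequence $\{X_j(t)\}_{j\in\mathbb N}$ is non-decreasing; (P3) $L_{(0,1)}\equiv0$, and for $j\ge1$, $L_{(j,j+1)}$ is non-decreasing with $L_{(j,j+1)}(0)=0$ and $\int_0^\infty(X_{j+1}(t)-X_j(t))\,dL_{(j,j+1)}(t)=0$. *)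

theory Defs
  imports "HOL-Probability.Probability"
begin

text \<open>
  Conventions. A process is a function \<open>W :: real \<Rightarrow> 'a \<Rightarrow> real\<close>, of which only the values at
  times \<open>t \<ge> 0\<close> matter; likewise a filtration is a family of measures, of which only the
  \<open>\<sigma>\<close>-algebras \<open>F t\<close> with \<open>t \<ge> 0\<close> matter. Particles are numbered \<open>1, 2, \<dots>\<close>, so a sequence
  indexed by \<open>\<nat>\<close> is used only on \<open>{1..}\<close>; \<open>L j\<close> stands for \<open>L\<^bsub>(j,j+1)\<^esub>\<close>, \<open>j \<ge> 0\<close>.
  Adaptedness is meant literally (no completion of \<open>F\<close>), whereas path properties are required
  almost surely, with one exceptional null set for all times.
\<close>

definition filtered_prob_space :: "'a measure \<Rightarrow> (real \<Rightarrow> 'a measure) \<Rightarrow> bool" where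
  "filtered_prob_space M F \<longleftrightarrow>
     prob_space M \<and>
     (\<forall>t\<ge>0. subalgebra M (F t)) \<and>
     (\<forall>s t. 0 \<le> s \<longrightarrow> s \<le> t \<longrightarrow> sets (F s) \<subseteq> sets (F t))"

definition adapted :: "(real \<Rightarrow> 'a measure) \<Rightarrow> (real \<Rightarrow> 'a \<Rightarrow> real) \<Rightarrow> bool" where
  "adapted F W \<longleftrightarrow> (\<forall>t\<ge>0. W t \<in> borel_measurable (F t))"

definition continuous_paths :: "'a measure \<Rightarrow> (real \<Rightarrow> 'a \<Rightarrow> real) \<Rightarrow> bool" where
  "continuous_paths M W \<longleftrightarrow> (AE \<omega> in M. continuous_on {0..} (\<lambda>t. W t \<omega>))"

definition standard_brownian_motion :: "'a measure \<Rightarrow> (real \<Rightarrow> 'a \<Rightarrow> real) \<Rightarrow> bool" where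
  "standard_brownian_motion M W \<longleftrightarrow>
     (\<forall>t\<ge>0. W t \<in> borel_measurable M) \<and>
     (AE \<omega> in M. W 0 \<omega> = 0) \<and>
     (\<forall>(\<tau> :: nat \<Rightarrow> real) n. 0 \<le> \<tau> 0 \<longrightarrow> mono \<tau> \<longrightarrow>
        prob_space.indep_vars M (\<lambda>_. borel) (\<lambda>k \<omega>. W (\<tau> (Suc k)) \<omega> - W (\<tau> k) \<omega>) {..<n}) \<and>
     (\<forall>s t. 0 \<le> s \<longrightarrow> s < t \<longrightarrow>
        distributed M lborel (\<lambda>\<omega>. W t \<omega> - W s \<omega>) (normal_density 0 (sqrt (t - s)))) \<and>
     continuous_paths M W"

definition future_increments :: "'a measure \<Rightarrow> (nat \<Rightarrow> real \<Rightarrow> 'a \<Rightarrow> real) \<Rightarrow> real \<Rightarrow> 'a set set" where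
  "future_increments M B t =
     sigma_sets (space M)
       {(\<lambda>\<omega>. B i (t + s) \<omega> - B i t \<omega>) -` A \<inter> space M | i s A. 1 \<le> i \<and> 0 \<le> s \<and> A \<in> sets borel}"

definition driving_brownian_motions ::
    "'a measure \<Rightarrow> (real \<Rightarrow> 'a measure) \<Rightarrow> (nat \<Rightarrow> real \<Rightarrow> 'a \<Rightarrow> real) \<Rightarrow> bool" where
  "driving_brownian_motions M F B \<longleftrightarrow>
     (\<forall>j\<ge>1. standard_brownian_motion M (B j) \<and> adapted F (B j)) \<and>
     prob_space.indep_vars M (\<lambda>_. PiM {0..} (\<lambda>_. borel)) (\<lambda>j \<omega>. \<lambda>t\<in>{0..}. B j t \<omega>) {1..} \<and>
     (\<forall>t\<ge>0. prob_space.indep_set M (sets (F t)) (future_increments M B t))"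

definition real_sequences :: "(nat \<Rightarrow> real) measure" where
  "real_sequences = PiM {1..} (\<lambda>_. borel)"

definition initial_conditions ::
    "'a measure \<Rightarrow> (real \<Rightarrow> 'a measure) \<Rightarrow> (nat \<Rightarrow> 'a \<Rightarrow> real) \<Rightarrow> bool" where
  "initial_conditions M F x \<longleftrightarrow>
     (\<forall>j\<ge>1. x j \<in> borel_measurable (F 0)) \<and>
     (AE \<omega> in M. mono_on {1..} (\<lambda>j. x j \<omega>))"

definition initial_distribution :: "'a measure \<Rightarrow> (nat \<Rightarrow> 'a \<Rightarrow> real) \<Rightarrow> (nat \<Rightarrow> real) measure" where
  "initial_distribution M x = distr M real_sequences (\<lambda>\<omega>. \<lambda>j\<in>{1..}. x j \<omega>)"

text \<open>
  The Lebesgue-Stieltjes measure \<open>dA\<close> of a non-decreasing continuous \<open>A\<close> on \<open>[0,\<infinity>)\<close>; \<open>A\<close> is extended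
  by the constant \<open>A 0\<close> to negative times, which therefore carry no mass.
\<close>
definition stieltjes_measure :: "(real \<Rightarrow> real) \<Rightarrow> real measure" where
  "stieltjes_measure A = interval_measure (\<lambda>t. A (max t 0))"

text \<open>
  The collection \<open>X\<close> solves the infinite system of competing Brownian particles and \<open>L\<close> are its
  associated local times. The integral in the last clause is taken in \<open>[0,\<infinity>]\<close>; its integrand is
  non-negative because the particles are ordered, so \<open>ennreal\<close> does not truncate.
\<close>
definition competing_particles_solution ::
    "'a measure \<Rightarrow> (real \<Rightarrow> 'a measure) \<Rightarrow> real \<Rightarrow> (nat \<Rightarrow> real) \<Rightarrow> (nat \<Rightarrow> 'a \<Rightarrow> real) \<Rightarrow>
     (nat \<Rightarrow> real \<Rightarrow> 'a \<Rightarrow> real) \<Rightarrow> (nat \<Rightarrow> real \<Rightarrow> 'a \<Rightarrow> real) \<Rightarrow>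
     (nat \<Rightarrow> real \<Rightarrow> 'a \<Rightarrow> real) \<Rightarrow> bool" where
  "competing_particles_solution M F p g x B X L \<longleftrightarrow>
     (\<forall>j\<ge>1. adapted F (X j) \<and> continuous_paths M (X j)) \<and>
     (\<forall>j. adapted F (L j) \<and> continuous_paths M (L j)) \<and>
     (AE \<omega> in M. \<forall>t\<ge>0. \<forall>j\<ge>1.
        X j t \<omega> = x j \<omega> + g j * t + B j t \<omega> + p * L (j - 1) t \<omega> - (1 - p) * L j t \<omega>) \<and>
     (AE \<omega> in M. \<forall>t\<ge>0. mono_on {1..} (\<lambda>j. X j t \<omega>)) \<and>
     (AE \<omega> in M. \<forall>t\<ge>0. L 0 t \<omega> = 0) \<and>
     (\<forall>j\<ge>1. AE \<omega> in M.
        mono_on {0..} (\<lambda>t. L j t \<omega>) \<and>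
        L j 0 \<omega> = 0 \<and>
        (\<integral>\<^sup>+t\<in>{0..}. ennreal (X (Suc j) t \<omega> - X j t \<omega>) \<partial>stieltjes_measure (\<lambda>t. L j t \<omega>)) = 0)"

end

theory Submission
  imports Defs
begin

text \<open>
  Uniqueness holds path by path. The gap \<open>Z j = X (j + 1) - X j\<close> equals
  \<open>y j + L j - q L (j + 1) - p L (j - 1)\<close>, where \<open>y j\<close> collects the initial values, the drifts and the
  Brownian motions and is therefore common to both solutions. As \<open>L j\<close> is non-decreasing and
  increases only when the gap \<open>Z j\<close> is zero, \<open>L j\<close> is the Skorokhod regulator of
  \<open>y j - q L (j + 1) - p L (j - 1)\<close>, and the regulator is a 1-Lipschitz function of the path in the
  uniform norm (\<open>regulator_le\<close>). Hence the distances
  \<open>d j = sup {\<bar>L j t - L' j t\<bar> | 0 \<le> t \<le> T}\<close> satisfy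
  \<open>d j \<le> q d (j + 1) + p d (j - 1)\<close> and \<open>d 0 = 0\<close>: the sequence \<open>d\<close> is subharmonic for the walk that
  steps up with probability \<open>q\<close> and down with probability \<open>p\<close>, and is zero at the origin.
  The harmonic functions of that walk that vanish at \<open>0\<close> are the multiples of \<open>(p / q) ^ j - 1\<close>, so a
  non-zero \<open>d\<close> would have to grow at least like \<open>(p / q) ^ j\<close>
  (\<open>subharmonic_subexponential_zero\<close>). The growth condition on the local times excludes this, so the
  local times agree, and then the positions agree as well.
\<close>

section \<open>The one-dimensional Skorokhod problem\<close>

lemma flat_where_positive:
  fixes Z A :: "real \<Rightarrow> real"
  assumes Z: "continuous_on {0..} Z" and A: "continuous_on {0..} A" and mono: "mono_on {0..} A"
    and int: "(\<integral>\<^sup>+t\<in>{0..}. ennreal (Z t) \<partial>stieltjes_measure A) = 0"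
    and st: "0 \<le> s" "s \<le> t" and pos: "\<And>u. s < u \<Longrightarrow> u \<le> t \<Longrightarrow> 0 < Z u"
  shows "A t = A s"
proof -
  let ?A = "\<lambda>u. A (max u 0)" and ?\<mu> = "stieltjes_measure A"
  have sets: "sets ?\<mu> = sets borel" by (simp add: stieltjes_measure_def)
  have "continuous_on UNIV ?A"
    by (intro continuous_on_compose2[OF A] continuous_intros) auto
  then have cont: "continuous (at_right a) ?A" for a
    by (simp add: continuous_on_eq_continuous_within continuous_at_imp_continuous_at_within)
  have monoA: "?A a \<le> ?A b" if "a \<le> b" for a b
    using mono that by (auto intro!: mono_onD[OF mono])
  have mass: "emeasure ?\<mu> {s<..t} = ennreal (A t - A s)"
    unfolding stieltjes_measure_def
    using emeasure_interval_measure_Ioc[of s t ?A] st monoA cont by simp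
  have "(\<lambda>u. Z u * indicator {0..} u) \<in> borel_measurable borel"
    using borel_measurable_continuous_on_indicator[OF _ Z] by (simp add: mult.commute)
  then have "(\<lambda>u. ennreal (Z u * indicator {0..} u)) \<in> borel_measurable borel" by measurable
  also have "(\<lambda>u. ennreal (Z u * indicator {0..} u)) = (\<lambda>u. ennreal (Z u) * indicator {0..} u)"
    by (auto simp: indicator_def)
  finally have "(\<lambda>u. ennreal (Z u) * indicator {0..} u) \<in> borel_measurable ?\<mu>"
    using measurable_cong_sets[OF sets refl] by blast
  then have "AE u in ?\<mu>. ennreal (Z u) * indicator {0..} u = 0"
    using int nn_integral_0_iff_AE by blast
  then have "AE u in ?\<mu>. u \<notin> {s<..t}"
  proof eventually_elim
    case (elim u)
    then show ?case using pos[of u] st by (auto simp: indicator_def ennreal_eq_0_iff)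
  qed
  then have "emeasure ?\<mu> {s<..t} = 0"
    by (subst (asm) AE_iff_measurable[OF _ refl])
      (auto simp: sets sets_eq_imp_space_eq[OF sets] greaterThanAtMost_def greaterThan_def
        atMost_def Int_def)
  then have "A t \<le> A s" using mass by (simp add: ennreal_eq_0_iff)
  moreover have "A s \<le> A t" using st by (auto intro!: mono_onD[OF mono])
  ultimately show ?thesis by simp
qed

text \<open>
  If \<open>A - A'\<close> exceeds \<open>c\<close> at time \<open>t\<close>, it does so on a whole interval \<open>(s, t]\<close> after the last time \<open>s\<close>
  at which it is at most \<open>c\<close>. There \<open>Z\<close> lies strictly above \<open>Z'\<close>, so \<open>Z\<close> is positive and \<open>A\<close> stays
  constant while \<open>A'\<close> can only grow; hence \<open>A - A'\<close> cannot have risen above \<open>c\<close>. Exchanging the two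
  problems gives the Lipschitz bound for the regulator \<open>A\<close> of the free path \<open>Z - A\<close>.
\<close>
lemma regulator_le:
  fixes Z Z' A A' :: "real \<Rightarrow> real"
  assumes Z: "continuous_on {0..} Z" and A: "continuous_on {0..} A" and mono: "mono_on {0..} A"
    and int: "(\<integral>\<^sup>+t\<in>{0..}. ennreal (Z t) \<partial>stieltjes_measure A) = 0"
    and A': "continuous_on {0..} A'" and mono': "mono_on {0..} A'"
    and Z': "\<And>u. 0 \<le> u \<Longrightarrow> 0 \<le> Z' u"
    and init: "A 0 = A' 0" and t: "0 \<le> t"
    and close: "\<And>u. 0 \<le> u \<Longrightarrow> u \<le> t \<Longrightarrow> \<bar>(Z u - A u) - (Z' u - A' u)\<bar> \<le> c"
  shows "A t - A' t \<le> c"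
proof (rule ccontr)
  assume above: "\<not> A t - A' t \<le> c"
  define S where "S = {0..t} \<inter> (\<lambda>u. A u - A' u) -` {..c}"
  have "continuous_on {0..t} (\<lambda>u. A u - A' u)"
    using A A' by (intro continuous_on_diff) (auto elim: continuous_on_subset)
  then have "closed S" unfolding S_def by (intro continuous_closed_preimage) auto
  moreover have "0 \<in> S" using close[of 0] init t by (auto simp: S_def)
  moreover have bdd: "bdd_above S" by (auto simp: S_def)
  ultimately have "Sup S \<in> S" by (intro closed_contains_Sup) auto
  define s where "s = Sup S"
  have s: "0 \<le> s" "s \<le> t" "A s - A' s \<le> c" using \<open>Sup S \<in> S\<close> by (auto simp: S_def s_def)
  have later: "c < A u - A' u" if "s < u" "u \<le> t" for u
  proof (rule ccontr)
    assume "\<not> c < A u - A' u"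
    then have "u \<in> S" using that s by (auto simp: S_def)
    then have "u \<le> s" unfolding s_def using bdd by (rule cSup_upper)
    then show False using that by simp
  qed
  have "0 < Z u" if "s < u" "u \<le> t" for u
    using later[OF that] close[of u] Z'[of u] that s by linarith
  then have "A t = A s" by (intro flat_where_positive[OF Z A mono int s(1,2)])
  moreover have "A' s \<le> A' t" using s by (auto intro!: mono_onD[OF mono'])
  ultimately show False using above s by linarith
qed

section \<open>Subharmonic sequences\<close>

text \<open>
  Subharmonicity says that the increments of \<open>d\<close> grow at least by the factor \<open>p / q\<close> in each step.
  Once one of them is positive, \<open>d\<close> itself is eventually bounded below by a positive multiple of
  \<open>(p / q) ^ j\<close>.
\<close>
lemma subharmonic_subexponential_zero:
  fixes d :: "nat \<Rightarrow> real"
  assumes p: "0 < p" and q: "0 < q" and pq: "p + q = 1"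
    and nonneg: "\<And>j. 0 \<le> d j" and zero: "d 0 = 0"
    and sub: "\<And>j. d (Suc j) \<le> q * d (Suc (Suc j)) + p * d j"
    and lim: "(\<lambda>m. (q / p) ^ m * d m) \<longlonglongrightarrow> 0"
  shows "d j = 0"
proof -
  define e where "e j = d (Suc j) - d j" for j
  have step: "(p / q) * e j \<le> e (Suc j)" for j
  proof -
    have "(p + q) * d (Suc j) \<le> q * d (Suc (Suc j)) + p * d j" using sub[of j] pq by simp
    then have "p * e j \<le> q * e (Suc j)" by (simp add: e_def algebra_simps)
    then show ?thesis using q by (simp add: field_simps)
  qed
  have "e k \<le> 0" for k
  proof (rule ccontr)
    assume k: "\<not> e k \<le> 0"
    have grow: "(p / q) ^ n * e k \<le> e (k + n)" for n
    proof (induction n)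
      case (Suc n)
      have "(p / q) * ((p / q) ^ n * e k) \<le> (p / q) * e (k + n)"
        using Suc p q by (intro mult_left_mono) auto
      also have "\<dots> \<le> e (k + Suc n)" using step[of "k + n"] by simp
      finally show ?case by (simp add: mult.assoc)
    qed simp
    have lower: "(q / p) ^ Suc k * e k \<le> (q / p) ^ (n + Suc k) * d (n + Suc k)" for n
    proof -
      have "(p / q) ^ n * e k \<le> d (n + Suc k)"
        using grow[of n] nonneg[of "k + n"] by (simp add: e_def add.commute)
      then have "(q / p) ^ (n + Suc k) * ((p / q) ^ n * e k) \<le> (q / p) ^ (n + Suc k) * d (n + Suc k)"
        using p q by (intro mult_left_mono) auto
      moreover
      have "(q / p) ^ n * (p / q) ^ n = 1"
        using p q by (simp add: power_mult_distrib[symmetric])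
      then have "(q / p) ^ (n + Suc k) * ((p / q) ^ n * e k) = (q / p) ^ Suc k * e k"
        unfolding power_add by (metis (no_types, lifting) mult.assoc mult.commute mult_1)
      ultimately show ?thesis by (simp only:)
    qed
    have "(q / p) ^ Suc k * e k \<le> 0"
      by (rule LIMSEQ_le_const[OF LIMSEQ_ignore_initial_segment[OF lim, of "Suc k"]])
        (use lower in blast)
    moreover have "0 < (q / p) ^ Suc k * e k" using p q k by (intro mult_pos_pos) auto
    ultimately show False by linarith
  qed
  then have "decseq d" by (intro decseq_SucI) (simp add: e_def)
  then have "d j \<le> d 0" by (rule decseqD) simp
  then show ?thesis using nonneg[of j] zero by simp
qed

section \<open>Uniqueness for a single path\<close>

text \<open>
  Here \<open>w j\<close> is the free path of particle \<open>j\<close>, that is \<open>x j + g j * t + B j t\<close> along one outcome. The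
  growth condition at the single time \<open>T\<close> controls all of \<open>[0, T]\<close>, because monotonicity bounds the
  difference of two local times there by the sum of their values at \<open>T\<close>.
\<close>
lemma local_times_unique:
  fixes X X' L L' w :: "nat \<Rightarrow> real \<Rightarrow> real"
  assumes p: "0 < p" and q: "0 < q" and pq: "p + q = 1" and T: "0 \<le> T"
    and X: "\<And>j t. 1 \<le> j \<Longrightarrow> 0 \<le> t \<Longrightarrow> X j t = w j t + p * L (j - 1) t - q * L j t"
    and X': "\<And>j t. 1 \<le> j \<Longrightarrow> 0 \<le> t \<Longrightarrow> X' j t = w j t + p * L' (j - 1) t - q * L' j t"
    and cX: "\<And>j. 1 \<le> j \<Longrightarrow> continuous_on {0..} (X j)"
    and cX': "\<And>j. 1 \<le> j \<Longrightarrow> continuous_on {0..} (X' j)"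
    and cL: "\<And>j. continuous_on {0..} (L j)" and cL': "\<And>j. continuous_on {0..} (L' j)"
    and ord: "\<And>t. 0 \<le> t \<Longrightarrow> mono_on {1..} (\<lambda>j. X j t)"
    and ord': "\<And>t. 0 \<le> t \<Longrightarrow> mono_on {1..} (\<lambda>j. X' j t)"
    and L0: "\<And>t. 0 \<le> t \<Longrightarrow> L 0 t = 0" and L'0: "\<And>t. 0 \<le> t \<Longrightarrow> L' 0 t = 0"
    and mono: "\<And>j. 1 \<le> j \<Longrightarrow> mono_on {0..} (L j)"
    and mono': "\<And>j. 1 \<le> j \<Longrightarrow> mono_on {0..} (L' j)"
    and init: "\<And>j. 1 \<le> j \<Longrightarrow> L j 0 = 0" and init': "\<And>j. 1 \<le> j \<Longrightarrow> L' j 0 = 0"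
    and int: "\<And>j. 1 \<le> j \<Longrightarrow>
      (\<integral>\<^sup>+t\<in>{0..}. ennreal (X (Suc j) t - X j t) \<partial>stieltjes_measure (L j)) = 0"
    and int': "\<And>j. 1 \<le> j \<Longrightarrow>
      (\<integral>\<^sup>+t\<in>{0..}. ennreal (X' (Suc j) t - X' j t) \<partial>stieltjes_measure (L' j)) = 0"
    and lim: "(\<lambda>m. (q / p) ^ m * L m T) \<longlonglongrightarrow> 0" and lim': "(\<lambda>m. (q / p) ^ m * L' m T) \<longlonglongrightarrow> 0"
    and t: "0 \<le> t" "t \<le> T"
  shows "L j t = L' j t"
proof -
  define d where "d j = (SUP t\<in>{0..T}. \<bar>L j t - L' j t\<bar>)" for j
  have bound: "\<bar>L j t - L' j t\<bar> \<le> L j T + L' j T" if "t \<in> {0..T}" for j t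
  proof (cases "j = 0")
    case False
    have "L j 0 \<le> L j t" "L j t \<le> L j T" "L' j 0 \<le> L' j t" "L' j t \<le> L' j T"
      using that False by (auto intro!: mono_onD[OF mono] mono_onD[OF mono'])
    then show ?thesis using init[of j] init'[of j] False by auto
  qed (use that L0 L'0 in auto)
  have bdd: "bdd_above ((\<lambda>t. \<bar>L j t - L' j t\<bar>) ` {0..T})" for j
    using bound by (intro bdd_aboveI2)
  have diff_le_d: "\<bar>L j t - L' j t\<bar> \<le> d j" if "t \<in> {0..T}" for j t
    unfolding d_def by (rule cSUP_upper[OF that bdd])
  have d_le: "d j \<le> c" if "\<And>t. t \<in> {0..T} \<Longrightarrow> \<bar>L j t - L' j t\<bar> \<le> c" for j c
    unfolding d_def using T that by (intro cSUP_least) auto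
  have nonneg: "0 \<le> d j" for j using diff_le_d[of 0 j] T by fastforce
  have zero: "d 0 = 0"
    using d_le[of 0 0] nonneg[of 0] L0 L'0 by fastforce
  have sub: "d (Suc i) \<le> q * d (Suc (Suc i)) + p * d i" for i
  proof (rule d_le)
    fix t assume t: "t \<in> {0..T}"
    let ?Z = "\<lambda>t. X (Suc (Suc i)) t - X (Suc i) t" and ?Z' = "\<lambda>t. X' (Suc (Suc i)) t - X' (Suc i) t"
    let ?c = "q * d (Suc (Suc i)) + p * d i"
    have cZ: "continuous_on {0..} ?Z" "continuous_on {0..} ?Z'"
      by (intro continuous_on_diff cX cX'; simp)+
    have gap: "0 \<le> ?Z u" "0 \<le> ?Z' u" if "0 \<le> u" for u
      using mono_onD[OF ord[OF that], of "Suc i" "Suc (Suc i)"]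
        mono_onD[OF ord'[OF that], of "Suc i" "Suc (Suc i)"] by auto
    have close: "\<bar>(?Z u - L (Suc i) u) - (?Z' u - L' (Suc i) u)\<bar> \<le> ?c" if "0 \<le> u" "u \<le> t" for u
    proof -
      have u: "u \<in> {0..T}" using that t by auto
      let ?D = "\<lambda>j. L j u - L' j u"
      (* The coefficient of L (Suc i) in the gap is p + q = 1. *)
      have "p * ?D (Suc i) + q * ?D (Suc i) = ?D (Suc i)"
        using pq by (metis distrib_right mult_1)
      then have "(?Z u - L (Suc i) u) - (?Z' u - L' (Suc i) u)
          = - (q * ?D (Suc (Suc i))) - p * ?D i"
        using that by (simp add: X X' algebra_simps)
      then have "\<bar>(?Z u - L (Suc i) u) - (?Z' u - L' (Suc i) u)\<bar>
          \<le> q * \<bar>?D (Suc (Suc i))\<bar> + p * \<bar>?D i\<bar>"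
        using p q abs_triangle_ineq4[of "- (q * ?D (Suc (Suc i)))" "p * ?D i"]
        by (simp add: abs_mult)
      also have "\<dots> \<le> ?c"
        using diff_le_d[OF u] p q by (intro add_mono mult_left_mono) auto
      finally show ?thesis .
    qed
    have "L (Suc i) t - L' (Suc i) t \<le> ?c"
      by (rule regulator_le[OF cZ(1) cL mono int cL' mono' gap(2)])
        (use init init' t close in auto)
    moreover have "L' (Suc i) t - L (Suc i) t \<le> ?c"
      by (rule regulator_le[OF cZ(2) cL' mono' int' cL mono gap(1)])
        (use init init' t close in \<open>auto simp: abs_minus_commute\<close>)
    ultimately show "\<bar>L (Suc i) t - L' (Suc i) t\<bar> \<le> ?c" by simp
  qed
  have "(\<lambda>m. (q / p) ^ m * d m) \<longlonglongrightarrow> 0"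
  proof (rule tendsto_sandwich[OF _ _ tendsto_const])
    show "(\<lambda>m. (q / p) ^ m * L m T + (q / p) ^ m * L' m T) \<longlonglongrightarrow> 0"
      using tendsto_add[OF lim lim'] by simp
    show "\<forall>\<^sub>F m in sequentially. 0 \<le> (q / p) ^ m * d m" using nonneg p q by simp
    have "(q / p) ^ m * d m \<le> (q / p) ^ m * (L m T + L' m T)" for m
      using d_le[OF bound] p q by (intro mult_left_mono) auto
    then show "\<forall>\<^sub>F m in sequentially. (q / p) ^ m * d m \<le> (q / p) ^ m * L m T + (q / p) ^ m * L' m T"
      by (simp add: distrib_left)
  qed
  then have "d j = 0"
    by (rule subharmonic_subexponential_zero[OF p q pq nonneg zero sub])
  then show ?thesis using diff_le_d[of t j] t by simp
qed

section \<open>Pathwise uniqueness\<close>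

text \<open>
  All path properties of a solution hold simultaneously off a single null set, since there are
  countably many particles.
\<close>
lemma solution_paths:
  assumes "competing_particles_solution M F p g x B X L"
  shows "AE \<omega> in M.
     (\<forall>j\<ge>1. continuous_on {0..} (\<lambda>t. X j t \<omega>)) \<and>
     (\<forall>j. continuous_on {0..} (\<lambda>t. L j t \<omega>)) \<and>
     (\<forall>t\<ge>0. \<forall>j\<ge>1. X j t \<omega> = x j \<omega> + g j * t + B j t \<omega> + p * L (j - 1) t \<omega> - (1 - p) * L j t \<omega>) \<and>
     (\<forall>t\<ge>0. mono_on {1..} (\<lambda>j. X j t \<omega>)) \<and>
     (\<forall>t\<ge>0. L 0 t \<omega> = 0) \<and>
     (\<forall>j\<ge>1. mono_on {0..} (\<lambda>t. L j t \<omega>)) \<and>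
     (\<forall>j\<ge>1. L j 0 \<omega> = 0) \<and>
     (\<forall>j\<ge>1. (\<integral>\<^sup>+t\<in>{0..}. ennreal (X (Suc j) t \<omega> - X j t \<omega>) \<partial>stieltjes_measure (\<lambda>t. L j t \<omega>)) = 0)"
proof -
  have "AE \<omega> in M. \<forall>j\<in>{1..}. continuous_on {0..} (\<lambda>t. X j t \<omega>)"
    using assms unfolding competing_particles_solution_def continuous_paths_def
    by (intro AE_ball_countable') auto
  moreover have "AE \<omega> in M. \<forall>j. continuous_on {0..} (\<lambda>t. L j t \<omega>)"
    using assms unfolding competing_particles_solution_def continuous_paths_def AE_all_countable
    by blast
  moreover have "AE \<omega> in M. \<forall>j\<in>{1..}. mono_on {0..} (\<lambda>t. L j t \<omega>) \<and> L j 0 \<omega> = 0 \<and>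
        (\<integral>\<^sup>+t\<in>{0..}. ennreal (X (Suc j) t \<omega> - X j t \<omega>) \<partial>stieltjes_measure (\<lambda>t. L j t \<omega>)) = 0"
    using assms unfolding competing_particles_solution_def
    by (intro AE_ball_countable') auto
  moreover have "AE \<omega> in M. \<forall>t\<ge>0. \<forall>j\<ge>1.
      X j t \<omega> = x j \<omega> + g j * t + B j t \<omega> + p * L (j - 1) t \<omega> - (1 - p) * L j t \<omega>"
    "AE \<omega> in M. \<forall>t\<ge>0. mono_on {1..} (\<lambda>j. X j t \<omega>)" "AE \<omega> in M. \<forall>t\<ge>0. L 0 t \<omega> = 0"
    using assms unfolding competing_particles_solution_def by blast+
  ultimately show ?thesis by eventually_elim auto
qed

theorem theorem2p7:
  fixes p q :: real
    and g :: "nat \<Rightarrow> real"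
    and \<gamma> :: "(nat \<Rightarrow> real) measure"
    and M :: "'a measure"
    and F :: "real \<Rightarrow> 'a measure"
    and B X X' L L' :: "nat \<Rightarrow> real \<Rightarrow> 'a \<Rightarrow> real"
    and x x' :: "nat \<Rightarrow> 'a \<Rightarrow> real"
  assumes "1 / 2 < p" and "p < 1" and "q = 1 - p"
    and "bdd_above ((\<lambda>j. \<bar>g j\<bar>) ` {1..})"
    and "prob_space \<gamma>" and "sets \<gamma> = sets real_sequences"
    and "AE y in \<gamma>. mono_on {1..} y"
    and "AE y in \<gamma>. limsup (\<lambda>m. ereal (y m / sqrt (real m))) = \<infinity>"
    and "filtered_prob_space M F"
    and "driving_brownian_motions M F B"
    and "initial_conditions M F x" and "initial_distribution M x = \<gamma>"
    and "initial_conditions M F x'" and "initial_distribution M x' = \<gamma>"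
    and "competing_particles_solution M F p g x B X L"
    and "competing_particles_solution M F p g x' B X' L'"
    and "AE \<omega> in M. \<forall>j\<ge>1. X j 0 \<omega> = X' j 0 \<omega>"
    and "\<And>T. 0 \<le> T \<Longrightarrow> AE \<omega> in M. (\<lambda>m. (q / p) ^ m * L m T \<omega>) \<longlonglongrightarrow> 0"
    and "\<And>T. 0 \<le> T \<Longrightarrow> AE \<omega> in M. (\<lambda>m. (q / p) ^ m * L' m T \<omega>) \<longlonglongrightarrow> 0"
  shows "AE \<omega> in M. \<forall>j\<ge>1. \<forall>t\<ge>0. X j t \<omega> = X' j t \<omega>"
proof -
  have pq: "0 < p" "0 < q" "p + q = 1" using assms(1-3) by auto
  have "AE \<omega> in M. \<forall>n. (\<lambda>m. (q / p) ^ m * L m (real n) \<omega>) \<longlonglongrightarrow> 0"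
    "AE \<omega> in M. \<forall>n. (\<lambda>m. (q / p) ^ m * L' m (real n) \<omega>) \<longlonglongrightarrow> 0"
    using assms(18,19) by (simp_all add: AE_all_countable)
  then show ?thesis
    using solution_paths[OF assms(15)] solution_paths[OF assms(16)] assms(17)
  proof eventually_elim
    case (elim \<omega>)
    note sol = elim(3)[folded \<open>q = 1 - p\<close>] and sol' = elim(4)[folded \<open>q = 1 - p\<close>]
    (* At time 0 the local times vanish, so equal starting positions force equal initial conditions. *)
    have "L j 0 \<omega> = 0" "L' j 0 \<omega> = 0" for j
      using sol sol' by (cases "j = 0"; simp)+
    then have x: "x j \<omega> = x' j \<omega>" if "1 \<le> j" for j
      using sol sol' elim(5) that by (auto dest!: spec[of _ j] spec[of _ "0::real"])
    define w where "w j t = x j \<omega> + g j * t + B j t \<omega>" for j t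
    have X: "X j t \<omega> = w j t + p * L (j - 1) t \<omega> - q * L j t \<omega>"
      and X': "X' j t \<omega> = w j t + p * L' (j - 1) t \<omega> - q * L' j t \<omega>" if "1 \<le> j" "0 \<le> t" for j t
      using sol sol' that x[of j] by (auto simp: w_def)
    have L: "L j t \<omega> = L' j t \<omega>" if "0 \<le> t" for j t
    proof -
      obtain n :: nat where n: "t \<le> real n" using real_arch_simple by blast
      show ?thesis
        by (rule local_times_unique[where X = "\<lambda>j t. X j t \<omega>" and X' = "\<lambda>j t. X' j t \<omega>"
              and L = "\<lambda>j t. L j t \<omega>" and L' = "\<lambda>j t. L' j t \<omega>" and w = w and T = "real n",
              OF pq])
          (use sol sol' X X' elim(1,2) that n in auto)
    qed
    show ?case using X X' L by simp
  qed
qed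

end
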